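(* Let $d\ge1$, let $\mathbf n=(n_1,\dots,n_d)$ be a tuple of positive integers, and let $n=\max\{n_i: i=1,\dots,d\}$. Then the ideal $I_\infty$ associated with the tensor space $\mathbb R^{n_1\times\cdots\times n_d}$ is theta-$n$ exact, i.e. $\mathrm{TH}_n(I_\infty)=\overline{\mathrm{conv}(\mathcal V_{\mathbb R}(I_\infty))}$.
   Context: $[\mathbf n]=[n_1]\times\cdots\times[n_d]$ with $[m]=\{1,\dots,m\}$; $\mathbb R[X]$ is the polynomial ring in the variables $x_a$, $a\in[\mathbf n]$. For $a,b\in[\mathbf n]$, $a\wedge b=(\min(a_i,b_i))_i$, $a\vee b=(\max(a_i,b_i))_i$, and $I_\infty=\langle x_a^2-1\ (a\in[\mathbf n]),\ x_ax_b-x_{a\wedge b}x_{a\vee b}\ (a,b\in[\mathbf n])\rangle$. $\mathcal V_{\mathbb R}(I)$ denotes the real zero set of $I$ in $\mathbb R^{n_1\times\cdots\times n_d}$. Theta bodies. For an ideal $I$ in $\mathbb R[X]$, $\deg(f+I)=\min\{\deg h: h\equiv f \bmod I\}$; $V_j=\{f+I:\deg(f+I)\le j\}$; $\Sigma_k(I)\subset V_{2k}$ is the set of classes $\sum_i h_i^2+I$ of finite sums of squares of polynomials with $\deg h_i\le k$; $\Sigma_k(I)^*=\{\ell\in V_{2k}^*:\ell(s)\ge 0\ \forall s\in\Sigma_k(I)\}$, where $V_{2k}^*$ is the space of linear functionals on $V_{2k}$. The theta-$k$ body of $I$ is $\mathrm{TH}_k(I)=\mathrm{cl}\{(\ell(x_a+I))_{a}:\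 \ell\in\Sigma_k(I)^*,\ \ell(1+I)=1\}$. *)

theory Defs
  imports
    "HOL-Analysis.Analysis"
    "HOL-Algebra.QuotRing"
    "HOL-Library.Poly_Mapping"
    "HOL-Library.Function_Algebras"
begin

text \<open>The pointwise vector space structure on functions; the topology on functions is the
  product topology of \<^theory>\<open>HOL-Analysis.Function_Topology\<close>.\<close>

instantiation "fun" :: (type, real_vector) real_vector
begin

definition scaleR_fun :: "real \<Rightarrow> ('a \<Rightarrow> 'b) \<Rightarrow> 'a \<Rightarrow> 'b"
  where "scaleR_fun c f = (\<lambda>x. c *\<^sub>R f x)"

instance
  by standard (auto simp: scaleR_fun_def plus_fun_def fun_eq_iff scaleR_add_right scaleR_add_left)

end

section \<open>Real polynomials in several variables\<close>

text \<open>A monomial maps each variable to its exponent, a polynomial maps each monomial to its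
  coefficient. The type has a variable for every element of \<^typ>\<open>'v\<close>; the polynomial ring in
  the variables from \<open>A\<close> is the subring \<open>poly_ring A\<close>.\<close>

type_synonym 'v rpoly = "('v \<Rightarrow>\<^sub>0 nat) \<Rightarrow>\<^sub>0 real"

definition pvar :: "'v \<Rightarrow> 'v rpoly"
  where "pvar v = Poly_Mapping.single (Poly_Mapping.single v 1) 1"

definition pconst :: "real \<Rightarrow> 'v rpoly"
  where "pconst c = Poly_Mapping.single 0 c"

definition pvars :: "'v rpoly \<Rightarrow> 'v set"
  where "pvars p = (\<Union>m\<in>Poly_Mapping.keys p. Poly_Mapping.keys m)"

definition monom_degree :: "('v \<Rightarrow>\<^sub>0 nat) \<Rightarrow> nat"
  where "monom_degree m = (\<Sum>v\<in>Poly_Mapping.keys m. Poly_Mapping.lookup m v)"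

text \<open>Convention: the zero polynomial has degree 0. This does not affect any of the conditions
  of the form \<open>degree \<le> k\<close> below.\<close>

definition total_degree :: "'v rpoly \<Rightarrow> nat"
  where "total_degree p = Max (insert 0 (monom_degree ` Poly_Mapping.keys p))"

definition peval :: "('v \<Rightarrow> real) \<Rightarrow> 'v rpoly \<Rightarrow> real"
  where "peval x p = (\<Sum>m\<in>Poly_Mapping.keys p. Poly_Mapping.lookup p m * (\<Prod>v\<in>Poly_Mapping.keys m. x v ^ Poly_Mapping.lookup m v))"

definition poly_ring :: "'v set \<Rightarrow> 'v rpoly ring"
  where "poly_ring A =
    \<lparr>carrier = {p. pvars p \<subseteq> A}, mult = (*), one = 1, zero = 0, add = (+)\<rparr>"

text \<open>Points of \<open>\<real>\<^sup>A\<close> are the functions vanishing outside \<open>A\<close>.\<close>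

definition coord_space :: "'v set \<Rightarrow> ('v \<Rightarrow> real) set"
  where "coord_space A = {x. \<forall>v. v \<notin> A \<longrightarrow> x v = 0}"

definition real_zeros :: "'v set \<Rightarrow> 'v rpoly set \<Rightarrow> ('v \<Rightarrow> real) set"
  where "real_zeros A I = {x \<in> coord_space A. \<forall>p\<in>I. peval x p = 0}"

section \<open>Theta bodies\<close>

definition residue_class :: "'v set \<Rightarrow> 'v rpoly set \<Rightarrow> 'v rpoly \<Rightarrow> 'v rpoly set"
  where "residue_class A I f = I +>\<^bsub>poly_ring A\<^esub> f"

definition class_degree :: "'v rpoly set \<Rightarrow> nat"
  where "class_degree C = (LEAST k. \<exists>h\<in>C. total_degree h = k)"

definition classes_upto :: "'v set \<Rightarrow> 'v rpoly set \<Rightarrow> nat \<Rightarrow> 'v rpoly set set"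
  where "classes_upto A I j = {C \<in> carrier (poly_ring A Quot I). class_degree C \<le> j}"

definition sos_classes :: "'v set \<Rightarrow> 'v rpoly set \<Rightarrow> nat \<Rightarrow> 'v rpoly set set"
  where "sos_classes A I k =
    {residue_class A I (\<Sum>h\<leftarrow>hs. h ^ 2) | hs.
       \<forall>h\<in>set hs. h \<in> carrier (poly_ring A) \<and> total_degree h \<le> k}"

text \<open>Linear functionals on a subspace \<open>V\<close> of the quotient algebra; multiplication of a class by
  a real \<open>c\<close> is multiplication by the class of the constant \<open>c\<close>. Values outside \<open>V\<close> are
  irrelevant.\<close>

definition linear_functional_on ::
    "'v set \<Rightarrow> 'v rpoly set \<Rightarrow> 'v rpoly set set \<Rightarrow> ('v rpoly set \<Rightarrow> real) \<Rightarrow> bool"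
  where "linear_functional_on A I V l \<longleftrightarrow>
    (\<forall>C\<in>V. \<forall>D\<in>V. l (C \<oplus>\<^bsub>poly_ring A Quot I\<^esub> D) = l C + l D) \<and>
    (\<forall>c. \<forall>C\<in>V. l (residue_class A I (pconst c) \<otimes>\<^bsub>poly_ring A Quot I\<^esub> C) = c * l C)"

definition sos_dual :: "'v set \<Rightarrow> 'v rpoly set \<Rightarrow> nat \<Rightarrow> ('v rpoly set \<Rightarrow> real) set"
  where "sos_dual A I k =
    {l. linear_functional_on A I (classes_upto A I (2 * k)) l \<and> (\<forall>s\<in>sos_classes A I k. l s \<ge> 0)}"

definition theta_body :: "'v set \<Rightarrow> 'v rpoly set \<Rightarrow> nat \<Rightarrow> ('v \<Rightarrow> real) set"
  where "theta_body A I k =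
    closure {(\<lambda>v. if v \<in> A then l (residue_class A I (pvar v)) else 0) | l.
               l \<in> sos_dual A I k \<and> l (residue_class A I 1) = 1}"

definition theta_exact :: "'v set \<Rightarrow> 'v rpoly set \<Rightarrow> nat \<Rightarrow> bool"
  where "theta_exact A I k \<longleftrightarrow> theta_body A I k = closure (convex hull (real_zeros A I))"

section \<open>The ideal of the tensor space\<close>

text \<open>For a tuple \<open>n\<close> indexed by a finite type \<^typ>\<open>'d\<close> (so that \<open>d = CARD('d) \<ge> 1\<close>), the
  multi-indices are functions \<^typ>\<open>'d \<Rightarrow> nat\<close>.\<close>

definition multi_indices :: "('d \<Rightarrow> nat) \<Rightarrow> ('d \<Rightarrow> nat) set"
  where "multi_indices n = {a. \<forall>i. a i \<in> {1..n i}}"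

definition I_infty :: "('d \<Rightarrow> nat) \<Rightarrow> ('d \<Rightarrow> nat) rpoly set"
  where "I_infty n = Idl\<^bsub>poly_ring (multi_indices n)\<^esub>
    ({pvar a ^ 2 - 1 | a. a \<in> multi_indices n} \<union>
     {pvar a * pvar b - pvar (\<lambda>i. min (a i) (b i)) * pvar (\<lambda>i. max (a i) (b i)) | a b.
        a \<in> multi_indices n \<and> b \<in> multi_indices n})"

end

theory Submission
  imports Defs
begin

text \<open>The relations \<open>x\<^sub>a\<^sup>2 = 1\<close> put the zeros of \<open>I\<^sub>\<infinity>\<close> among the sign patterns, and the
  proof rests on two facts.

  First, every residue class has a representative of degree at most \<open>n = max n\<^sub>i\<close>. The relation
  \<open>x\<^sub>a x\<^sub>b = x\<^sub>a\<^sub>\<and>\<^sub>b x\<^sub>a\<^sub>\<or>\<^sub>b\<close> says that \<open>x\<^sub>a x\<^sub>b\<close> depends only on the meet and the join of \<open>a\<close> and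
  \<open>b\<close>, and these do not change when \<open>a\<close> and \<open>b\<close> exchange one coordinate (\<open>swap_coordinate\<close>).
  Think of a monomial of degree \<open>k\<close> as \<open>k\<close> multi-indices written below each other; modulo the ideal
  each column may be permuted separately. If \<open>k\<close> exceeds all \<open>n\<^sub>i\<close>, every column contains a repeated
  entry by the pigeonhole principle. Moving these repetitions to the first two rows makes the two
  rows equal, and their product is congruent to 1 (\<open>align_first_two\<close>, \<open>reduce_product\<close>). So the
  degree drops by 2 until it is at most \<open>n\<close> (\<open>representative\<close>).

  Second, an ideal that contains all \<open>x\<^sub>a\<^sup>2 - 1\<close> is theta-\<open>k\<close> exact as soon as all classes have
  representatives of degree at most \<open>k\<close> (\<open>theta_exact_if_representable\<close>). For a sign pattern \<open>s\<close> let
  \<open>\<delta>\<^sub>s = \<Prod>\<^sub>a (1 + s\<^sub>a x\<^sub>a) / 2\<close>. These polynomials sum to 1, and \<open>p \<delta>\<^sub>s\<close> is congruent to \<open>p(s) \<delta>\<^sub>s\<close> for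
  every polynomial \<open>p\<close> (\<open>mult_sign_indicator\<close>). Consequently \<open>\<delta>\<^sub>s\<close> is idempotent, it lies in the ideal
  unless \<open>s\<close> is a zero of the ideal, and \<open>x\<^sub>a\<close> is congruent to \<open>\<Sum>\<^sub>s s\<^sub>a \<delta>\<^sub>s\<close>. An admissible functional
  \<open>l\<close> satisfies \<open>l(\<delta>\<^sub>s) = l(\<delta>\<^sub>s\<^sup>2) \<ge> 0\<close>, so its point \<open>(l(x\<^sub>a))\<^sub>a\<close> is the convex combination of the
  zeros \<open>s\<close> with weights \<open>l(\<delta>\<^sub>s)\<close>. The converse inclusion holds for all ideals, since evaluations at
  zeros are admissible.\<close>

section \<open>The polynomial ring\<close>

lemma poly_ring_simps [simp]:
  "carrier (poly_ring A) = {p. pvars p \<subseteq> A}"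
  "mult (poly_ring A) = (*)" "one (poly_ring A) = 1"
  "zero (poly_ring A) = 0" "add (poly_ring A) = (+)"
  by (auto simp: poly_ring_def)

lemma pvars_0 [simp]: "pvars 0 = {}"
  and pvars_1 [simp]: "pvars 1 = {}"
  and pvars_pconst [simp]: "pvars (pconst c) = {}"
  and pvars_pvar [simp]: "pvars (pvar v) = {v}"
  by (auto simp: pvars_def pconst_def pvar_def)

lemma pvars_uminus [simp]: "pvars (- p) = pvars p"
  by (simp add: pvars_def set_eq_iff in_keys_iff)

lemma pvars_add: "pvars p \<subseteq> A \<Longrightarrow> pvars q \<subseteq> A \<Longrightarrow> pvars (p + q) \<subseteq> A"
  using keys_add[of p q] unfolding pvars_def by blast

lemma pvars_diff: "pvars p \<subseteq> A \<Longrightarrow> pvars q \<subseteq> A \<Longrightarrow> pvars (p - q) \<subseteq> A"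
  using pvars_add[of p A "- q"] by simp

lemma pvars_mult:
  assumes "pvars p \<subseteq> A" "pvars q \<subseteq> A" shows "pvars (p * q) \<subseteq> A"
proof -
  have "Poly_Mapping.keys m \<subseteq> A" if "m \<in> Poly_Mapping.keys (p * q)" for m
  proof -
    obtain a b where "m = a + b" "a \<in> Poly_Mapping.keys p" "b \<in> Poly_Mapping.keys q"
      using \<open>m \<in> _\<close> keys_mult[of p q] by blast
    then show ?thesis
      using assms keys_add[of a b] unfolding pvars_def by blast
  qed
  then show ?thesis by (auto simp: pvars_def)
qed

lemma pvars_sum: "(\<And>i. i \<in> S \<Longrightarrow> pvars (f i) \<subseteq> A) \<Longrightarrow> pvars (sum f S) \<subseteq> A"
  by (induction S rule: infinite_finite_induct) (auto simp: pvars_add)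

lemma pvars_prod: "(\<And>i. i \<in> S \<Longrightarrow> pvars (f i) \<subseteq> A) \<Longrightarrow> pvars (prod f S) \<subseteq> A"
  by (induction S rule: infinite_finite_induct) (auto simp: pvars_mult)

lemma pvars_power: "pvars p \<subseteq> A \<Longrightarrow> pvars (p ^ k) \<subseteq> A"
  by (induction k) (auto simp: pvars_mult)

lemmas pvars_closed = pvars_add pvars_diff pvars_mult pvars_sum pvars_prod pvars_power

lemma pconst_add: "pconst (c + d) = pconst c + pconst d"
  and pconst_mult: "pconst (c * d) = pconst c * pconst d"
  and pconst_uminus: "pconst (- c) = - pconst c"
  and pconst_0 [simp]: "pconst 0 = 0"
  and pconst_1 [simp]: "pconst 1 = 1"
  by (simp_all add: pconst_def single_add mult_single single_uminus)

lemma cring_poly_ring: "cring (poly_ring A)"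
proof (rule cringI)
  show "abelian_group (poly_ring A)"
  proof (rule abelian_groupI)
    fix p assume "p \<in> carrier (poly_ring A)"
    then show "\<exists>q\<in>carrier (poly_ring A). q \<oplus>\<^bsub>poly_ring A\<^esub> p = \<zero>\<^bsub>poly_ring A\<^esub>"
      by (intro bexI[of _ "- p"]) auto
  qed (auto simp: pvars_add add_ac)
  show "comm_monoid (poly_ring A)"
    by (rule comm_monoidI) (auto simp: pvars_mult mult_ac)
qed (auto simp: algebra_simps)

lemma poly_mapping_eq_sum_single:
  "p = (\<Sum>m\<in>Poly_Mapping.keys p. Poly_Mapping.single m (Poly_Mapping.lookup p m))"
proof (rule poly_mapping_eqI)
  fix k
  show "Poly_Mapping.lookup p k =
    Poly_Mapping.lookup (\<Sum>m\<in>Poly_Mapping.keys p. Poly_Mapping.single m (Poly_Mapping.lookup p m)) k"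
    by (simp add: lookup_sum lookup_single when_def in_keys_iff)
qed

lemma single_eq_variable_product:
  "Poly_Mapping.single m c
    = pconst c * (\<Prod>v\<in>Poly_Mapping.keys m. pvar v ^ Poly_Mapping.lookup m v)"
proof -
  have pow: "pvar v ^ k = Poly_Mapping.single (Poly_Mapping.single v k) 1" for v :: 'a and k
    by (induction k) (auto simp: pvar_def mult_single simp flip: single_add)
  have "(\<Prod>v\<in>S. Poly_Mapping.single (g v) (1::real)) = Poly_Mapping.single (sum g S) 1"
    if "finite S" for S :: "'a set" and g
    using that by induction (auto simp: mult_single)
  from this[OF finite_keys, of "\<lambda>v. Poly_Mapping.single v (Poly_Mapping.lookup m v)" m]
  show ?thesis
    by (simp add: pow pconst_def mult_single flip: poly_mapping_eq_sum_single)
qed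

text \<open>A monomial is handled below as a word in the variables: reducing its degree modulo an ideal
  means shortening the word, and for this the individual occurrences of a variable matter.\<close>
lemma monomial_eq_prod_list:
  obtains vs where "set vs \<subseteq> Poly_Mapping.keys m"
    "Poly_Mapping.single m c = pconst c * prod_list (map pvar vs)"
proof -
  have "\<exists>vs. set vs \<subseteq> S \<and> (\<Prod>v\<in>S. (pvar v :: 'a rpoly) ^ g v) = prod_list (map pvar vs)"
    if "finite S" for S :: "'a set" and g :: "'a \<Rightarrow> nat"
    using that
  proof induction
    case empty
    then show ?case by auto
  next
    case (insert v S)
    then obtain vs where vs: "set vs \<subseteq> S" "(\<Prod>v\<in>S. pvar v ^ g v) = prod_list (map pvar vs)"
      by blast
    with insert show ?case
      by (intro exI[of _ "replicate (g v) v @ vs"]) (auto simp: prod_list_replicate)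
  qed
  from this[OF finite_keys, of m "Poly_Mapping.lookup m"] that show ?thesis
    unfolding single_eq_variable_product by auto
qed

lemma rpoly_single_induct [case_names single add]:
  assumes "\<And>m c. P (Poly_Mapping.single m c)" "\<And>p q. P p \<Longrightarrow> P q \<Longrightarrow> P (p + q)"
  shows "P (p :: 'v rpoly)"
proof -
  have "P (sum f S)" if "\<And>m. P (f m)" for f :: "('v \<Rightarrow>\<^sub>0 nat) \<Rightarrow> 'v rpoly" and S
    using assms(1)[of 0 0]
    by (induction S rule: infinite_finite_induct) (auto intro: assms(2) that)
  from this[of "\<lambda>m. Poly_Mapping.single m (Poly_Mapping.lookup p m)" "Poly_Mapping.keys p"]
  show ?thesis
    using assms(1) by (simp flip: poly_mapping_eq_sum_single)
qed

text \<open>Multiplication by one variable at a time lets a congruence modulo an ideal be extended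
  from the variables to all polynomials.\<close>
lemma poly_ring_induct [consumes 1, case_names pconst pvar add]:
  assumes "pvars p \<subseteq> A"
    and const: "\<And>c. P (pconst c)"
    and var: "\<And>v p. v \<in> A \<Longrightarrow> pvars p \<subseteq> A \<Longrightarrow> P p \<Longrightarrow> P (pvar v * p)"
    and add: "\<And>p q. pvars p \<subseteq> A \<Longrightarrow> pvars q \<subseteq> A \<Longrightarrow> P p \<Longrightarrow> P q \<Longrightarrow> P (p + q)"
  shows "P p"
proof -
  have mono: "P (Poly_Mapping.single m c) \<and> pvars (Poly_Mapping.single m c) \<subseteq> A"
    if "Poly_Mapping.keys m \<subseteq> A" for m c
  proof -
    obtain vs where vs: "set vs \<subseteq> Poly_Mapping.keys m"
      "Poly_Mapping.single m c = pconst c * prod_list (map pvar vs)"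
      by (rule monomial_eq_prod_list)
    have "set vs \<subseteq> A" using vs(1) that by blast
    then have "P (pconst c * prod_list (map pvar vs)) \<and> pvars (pconst c * prod_list (map pvar vs)) \<subseteq> A"
    proof (induction vs)
      case (Cons v vs)
      then show ?case
        using var[of v "pconst c * prod_list (map pvar vs)"]
          pvars_mult[of "pvar v" A "pconst c * prod_list (map pvar vs)"]
        by (simp add: mult.left_commute)
    qed (simp add: const)
    then show ?thesis by (simp add: vs(2))
  qed
  have "P (sum f S) \<and> pvars (sum f S) \<subseteq> A"
    if "\<And>m. m \<in> S \<Longrightarrow> P (f m) \<and> pvars (f m) \<subseteq> A" for f :: "('a \<Rightarrow>\<^sub>0 nat) \<Rightarrow> 'a rpoly" and S
    using that const[of 0]
    by (induction S rule: infinite_finite_induct) (auto intro!: add simp: pvars_add)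
  from this[of "Poly_Mapping.keys p" "\<lambda>m. Poly_Mapping.single m (Poly_Mapping.lookup p m)"]
  show ?thesis
    using mono assms(1) poly_mapping_eq_sum_single[of p] by (auto simp: pvars_def)
qed

section \<open>Evaluation and degree\<close>

lemma peval_superset:
  assumes "finite S" "Poly_Mapping.keys p \<subseteq> S"
  shows "peval x p = (\<Sum>m\<in>S. Poly_Mapping.lookup p m * (\<Prod>v\<in>Poly_Mapping.keys m. x v ^ Poly_Mapping.lookup m v))"
  unfolding peval_def using assms by (intro sum.mono_neutral_left) (auto simp: in_keys_iff)

lemma peval_add [simp]: "peval x (p + q) = peval x p + peval x q"
proof -
  let ?S = "Poly_Mapping.keys p \<union> Poly_Mapping.keys q"
  have "Poly_Mapping.keys (p + q) \<subseteq> ?S" by (rule keys_add)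
  then show ?thesis
    by (simp add: peval_superset[of ?S] lookup_add distrib_right sum.distrib)
qed

lemma peval_single:
  "peval x (Poly_Mapping.single m c) = c * (\<Prod>v\<in>Poly_Mapping.keys m. x v ^ Poly_Mapping.lookup m v)"
  by (subst peval_superset[of "{m}"]) auto

lemma peval_0 [simp]: "peval x 0 = 0"
  and peval_pconst [simp]: "peval x (pconst c) = c"
  and peval_pvar [simp]: "peval x (pvar v) = x v"
  by (simp_all add: peval_single pconst_def pvar_def, simp add: peval_def)

lemma peval_1 [simp]: "peval x 1 = 1"
  using peval_pconst[of x 1] by (simp del: peval_pconst)

lemma peval_mult [simp]: "peval x (p * q) = peval x p * peval x q"
proof -
  have mon: "(\<Prod>v\<in>Poly_Mapping.keys m. x v ^ Poly_Mapping.lookup m v)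
      = (\<Prod>v\<in>S. x v ^ Poly_Mapping.lookup m v)"
    if "finite S" "Poly_Mapping.keys m \<subseteq> S" for m :: "'a \<Rightarrow>\<^sub>0 nat" and S
    using that by (intro prod.mono_neutral_left) (auto simp: in_keys_iff)
  have "peval x (Poly_Mapping.single (m + m') (c * c'))
     = peval x (Poly_Mapping.single m c) * peval x (Poly_Mapping.single m' c')" for m m' c c'
  proof -
    let ?S = "Poly_Mapping.keys m \<union> Poly_Mapping.keys m'"
    show ?thesis
      using mon[of ?S m] mon[of ?S m'] mon[of ?S "m + m'"] keys_add[of m m']
      unfolding peval_single by (simp add: lookup_add power_add prod.distrib)
  qed
  then have single: "peval x (Poly_Mapping.single m c * q)
      = peval x (Poly_Mapping.single m c) * peval x q" for m c
    by (induction q rule: rpoly_single_induct) (auto simp: mult_single distrib_left)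
  show ?thesis
    by (induction p rule: rpoly_single_induct) (auto simp: single distrib_right)
qed

lemma peval_uminus [simp]: "peval x (- p) = - peval x p"
  using peval_add[of x p "- p"] by (simp del: peval_add)

lemma peval_diff [simp]: "peval x (p - q) = peval x p - peval x q"
  using peval_add[of x p "- q"] by simp

lemma peval_power [simp]: "peval x (p ^ k) = peval x p ^ k"
  by (induction k) auto

lemma peval_prod: "peval x (prod f S) = (\<Prod>i\<in>S. peval x (f i))"
  by (induction S rule: infinite_finite_induct) auto

lemma total_degree_le_iff:
  "total_degree p \<le> k \<longleftrightarrow> (\<forall>m\<in>Poly_Mapping.keys p. monom_degree m \<le> k)"
  by (auto simp: total_degree_def)

lemma monom_degree_add: "monom_degree (m + m') = monom_degree m + monom_degree m'"
proof -
  let ?S = "Poly_Mapping.keys m \<union> Poly_Mapping.keys m'"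
  have sup: "monom_degree n = (\<Sum>v\<in>?S. Poly_Mapping.lookup n v)" if "Poly_Mapping.keys n \<subseteq> ?S" for n
    unfolding monom_degree_def using that
    by (intro sum.mono_neutral_left) (auto simp: in_keys_iff)
  show ?thesis
    using keys_add[of m m'] by (simp add: sup lookup_add sum.distrib)
qed

lemma total_degree_add_le: "total_degree p \<le> k \<Longrightarrow> total_degree q \<le> k \<Longrightarrow> total_degree (p + q) \<le> k"
  using keys_add[of p q] by (auto simp: total_degree_le_iff)

lemma total_degree_mult_le:
  assumes "total_degree p \<le> j" "total_degree q \<le> k"
  shows "total_degree (p * q) \<le> j + k"
  unfolding total_degree_le_iff
proof
  fix m assume "m \<in> Poly_Mapping.keys (p * q)"
  then obtain a b where "m = a + b" "a \<in> Poly_Mapping.keys p" "b \<in> Poly_Mapping.keys q"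
    using keys_mult[of p q] by blast
  then show "monom_degree m \<le> j + k"
    using assms by (auto simp: total_degree_le_iff monom_degree_add intro!: add_mono)
qed

lemma total_degree_pconst [simp]: "total_degree (pconst c) = 0"
  and total_degree_pvar [simp]: "total_degree (pvar v) \<le> 1"
  and total_degree_1 [simp]: "total_degree 1 = 0"
  by (auto simp: total_degree_le_iff pconst_def pvar_def monom_degree_def 
    simp flip: le_zero_eq)

section \<open>Residue classes modulo an ideal\<close>

locale poly_ideal =
  fixes A :: "'v set" and I :: "'v rpoly set"
  assumes ideal: "ideal I (poly_ring A)"
begin

sublocale ideal I "poly_ring A" by (rule ideal)

lemma in_ring: "f \<in> I \<Longrightarrow> pvars f \<subseteq> A"
  using a_Hcarr by simp

lemma zero_mem [simp]: "0 \<in> I"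
  using additive_subgroup.zero_closed[OF is_additive_subgroup] by simp

lemma add_mem: "f \<in> I \<Longrightarrow> g \<in> I \<Longrightarrow> f + g \<in> I"
  using additive_subgroup.a_closed[OF is_additive_subgroup, of f g] by simp

lemma mult_mem: "pvars f \<subseteq> A \<Longrightarrow> g \<in> I \<Longrightarrow> f * g \<in> I"
  using I_l_closed[of g f] by simp

lemma uminus_mem: "f \<in> I \<Longrightarrow> - f \<in> I"
  using mult_mem[of "- 1" f] by simp

lemma diff_mem: "f \<in> I \<Longrightarrow> g \<in> I \<Longrightarrow> f - g \<in> I"
  using add_mem[of f "- g"] by (simp add: uminus_mem)

lemma cong_trans: "f - g \<in> I \<Longrightarrow> g - h \<in> I \<Longrightarrow> f - h \<in> I"
  using add_mem[of "f - g" "g - h"] by simp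

lemma residue_class_eq: "residue_class A I f = {g. g - f \<in> I}"
proof -
  have "g \<in> (\<Union>h\<in>I. {h + f}) \<longleftrightarrow> g - f \<in> I" for g
  proof
    assume "g - f \<in> I"
    then show "g \<in> (\<Union>h\<in>I. {h + f})" by (rule UN_I) simp
  qed auto
  then show ?thesis by (auto simp: residue_class_def a_r_coset_def')
qed

lemma residue_class_cong:
  assumes "f - g \<in> I" shows "residue_class A I f = residue_class A I g"
proof -
  have "h - f \<in> I \<longleftrightarrow> h - g \<in> I" for h
    using add_mem[OF _ assms, of "h - f"] diff_mem[OF _ assms, of "h - g"] by auto
  then show ?thesis by (simp add: residue_class_eq)
qed

lemma quotient_carrier:
  "carrier (poly_ring A Quot I) = residue_class A I ` {f. pvars f \<subseteq> A}"
  by (auto simp: FactRing_def A_RCOSETS_def' residue_class_def)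

lemma residue_class_add:
  "pvars f \<subseteq> A \<Longrightarrow> pvars g \<subseteq> A \<Longrightarrow>
   residue_class A I f \<oplus>\<^bsub>poly_ring A Quot I\<^esub> residue_class A I g = residue_class A I (f + g)"
  using a_rcos_sum[of f g] by (simp add: FactRing_def residue_class_def)

lemma residue_class_mult:
  "pvars f \<subseteq> A \<Longrightarrow> pvars g \<subseteq> A \<Longrightarrow>
   residue_class A I f \<otimes>\<^bsub>poly_ring A Quot I\<^esub> residue_class A I g = residue_class A I (f * g)"
  using rcoset_mult_add[of f g] by (simp add: FactRing_def residue_class_def)

text \<open>A single representative of small degree bounds the degree of the class, because the degree
  of a class is a minimum.\<close>
lemma residue_class_in_classes_upto:
  assumes "pvars f \<subseteq> A" "f - h \<in> I" "total_degree h \<le> j"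
  shows "residue_class A I f \<in> classes_upto A I j"
proof -
  have "h \<in> residue_class A I f"
    using uminus_mem[OF assms(2)] by (simp add: residue_class_eq)
  then have "class_degree (residue_class A I f) \<le> total_degree h"
    unfolding class_degree_def by (intro Least_le) auto
  with assms show ?thesis
    by (auto simp: classes_upto_def quotient_carrier)
qed

lemma classes_uptoE:
  assumes "C \<in> classes_upto A I j"
  obtains f where "pvars f \<subseteq> A" "C = residue_class A I f"
  using assms by (auto simp: classes_upto_def quotient_carrier)

text \<open>On the residue classes of an ideal the choice of representative is immaterial as soon as
  \<open>z\<close> is a zero of that ideal, so a zero defines a functional on the quotient.\<close>
definition eval_at_class :: "('v \<Rightarrow> real) \<Rightarrow> 'v rpoly set \<Rightarrow> real"
  where "eval_at_class z C = peval z (SOME f. f \<in> C)"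

lemma eval_at_residue_class:
  assumes "z \<in> real_zeros A I"
  shows "eval_at_class z (residue_class A I f) = peval z f"
proof -
  have "f \<in> residue_class A I f" by (simp add: residue_class_eq)
  then have "(SOME g. g \<in> residue_class A I f) \<in> residue_class A I f" by (rule someI)
  then have "(SOME g. g \<in> residue_class A I f) - f \<in> I" by (simp add: residue_class_eq)
  then have "peval z ((SOME g. g \<in> residue_class A I f) - f) = 0"
    using assms unfolding real_zeros_def by blast
  then show ?thesis by (simp add: eval_at_class_def)
qed

lemma eval_at_class_in_sos_dual:
  assumes z: "z \<in> real_zeros A I"
  shows "eval_at_class z \<in> sos_dual A I k"
proof -
  have "peval z (sum_list (map (\<lambda>h. h\<^sup>2) hs)) \<ge> 0" for hs
    by (induction hs) auto
  moreover have "linear_functional_on A I (classes_upto A I (2 * k)) (eval_at_class z)"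
    unfolding linear_functional_on_def
    by (auto elim!: classes_uptoE simp: residue_class_add residue_class_mult eval_at_residue_class[OF z])
  ultimately show ?thesis
    by (auto simp: sos_dual_def sos_classes_def eval_at_residue_class[OF z])
qed

lemma sos_dual_convex:
  assumes "l \<in> sos_dual A I k" "l' \<in> sos_dual A I k" "u \<ge> 0" "v \<ge> 0"
  shows "(\<lambda>C. u * l C + v * l' C) \<in> sos_dual A I k"
  using assms by (auto simp: sos_dual_def linear_functional_on_def algebra_simps)

text \<open>This inclusion holds for every ideal and every level: evaluation at a real zero is an
  admissible functional whose coordinates are those of the zero, and admissible functionals
  are stable under convex combinations.\<close>
lemma convex_hull_zeros_subset_theta_body:
  "closure (convex hull (real_zeros A I)) \<subseteq> theta_body A I k"
proof -
  let ?pt = "\<lambda>l v. if v \<in> A then l (residue_class A I (pvar v)) else (0::real)"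
  let ?S = "{?pt l | l. l \<in> sos_dual A I k \<and> l (residue_class A I 1) = 1}"
  have "convex ?S"
  proof (rule convexI, goal_cases)
    case (1 x y u v)
    then obtain l l' where
      "l \<in> sos_dual A I k" "l (residue_class A I 1) = 1" "x = ?pt l"
      "l' \<in> sos_dual A I k" "l' (residue_class A I 1) = 1" "y = ?pt l'"
      by blast
    with 1 show ?case
      by (intro CollectI exI[of _ "\<lambda>C. u * l C + v * l' C"] conjI sos_dual_convex)
        (auto simp: scaleR_fun_def plus_fun_def fun_eq_iff)
  qed
  moreover have "real_zeros A I \<subseteq> ?S"
  proof
    fix z assume z: "z \<in> real_zeros A I"
    then show "z \<in> ?S"
      by (intro CollectI exI[of _ "eval_at_class z"] conjI eval_at_class_in_sos_dual)
        (auto simp: fun_eq_iff eval_at_residue_class real_zeros_def coord_space_def)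
  qed
  ultimately have "convex hull (real_zeros A I) \<subseteq> ?S"
    by (simp add: hull_minimal)
  then show ?thesis
    unfolding theta_body_def by (rule closure_mono)
qed

end

section \<open>Ideals that force the variables to be signs\<close>

definition sign_patterns :: "'v set \<Rightarrow> ('v \<Rightarrow> real) set"
  where "sign_patterns A = A \<rightarrow>\<^sub>E {1, - 1}"

text \<open>As a function on \<open>{1, -1}\<^sup>A\<close> this polynomial is the indicator of the point \<open>s\<close>. Modulo the
  squares \<open>x\<^sub>v\<^sup>2 - 1\<close> these polynomials form a complete system of orthogonal idempotents.\<close>
definition sign_indicator :: "'v set \<Rightarrow> ('v \<Rightarrow> real) \<Rightarrow> 'v rpoly"
  where "sign_indicator A s = (\<Prod>v\<in>A. pconst (1/2) * (1 + pconst (s v) * pvar v))"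

lemma pvars_sign_indicator: "pvars (sign_indicator A s) \<subseteq> A"
  unfolding sign_indicator_def by (intro pvars_closed) auto

text \<open>Expanding \<open>1 = \<Prod>\<^sub>v ((1 + x\<^sub>v) / 2 + (1 - x\<^sub>v) / 2)\<close> produces exactly the indicators. The
  identity holds in the polynomial ring, before any reduction.\<close>
lemma sum_sign_indicator:
  assumes "finite A"
  shows "(\<Sum>s\<in>sign_patterns A. sign_indicator A s) = 1"
proof -
  have "pconst (1/2) * (1 + pconst 1 * pvar v) + pconst (1/2) * (1 + pconst (-1) * pvar v) = (1 :: 'a rpoly)" for v
  proof -
    have "pconst (1/2) * (1 + pconst 1 * pvar v) + pconst (1/2) * (1 + pconst (-1) * pvar v)
      = pconst (1/2) + (pconst (1/2) :: 'a rpoly)"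
      by (simp add: pconst_uminus algebra_simps)
    also have "\<dots> = 1" by (simp flip: pconst_add)
    finally show ?thesis .
  qed
  then show ?thesis
    using prod_sum_PiE[OF assms, of "\<lambda>_. {1, -1}" "\<lambda>v t. pconst (1/2) * (1 + pconst t * pvar v)"]
    by (simp add: sign_patterns_def sign_indicator_def)
qed

locale sign_poly_ideal = poly_ideal +
  assumes finite_vars: "finite A"
    and square_mem: "v \<in> A \<Longrightarrow> pvar v ^ 2 - 1 \<in> I"
begin

text \<open>The factor of the indicator that belongs to \<open>v\<close> absorbs \<open>x\<^sub>v\<close>, since
  \<open>(x - c) (1 + c x) = c (x\<^sup>2 - 1)\<close> whenever \<open>c\<^sup>2 = 1\<close>.\<close>
lemma pvar_mult_sign_indicator:
  assumes s: "s \<in> sign_patterns A" and v: "v \<in> A"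
  shows "pvar v * sign_indicator A s - pconst (s v) * sign_indicator A s \<in> I"
proof -
  let ?r = "\<Prod>w\<in>A - {v}. pconst (1/2) * (1 + pconst (s w) * pvar w)"
  have "s v * s v = 1" using s v by (auto simp: sign_patterns_def PiE_iff)
  then have c: "pconst (s v) * pconst (s v) = (1 :: 'a rpoly)"
    by (simp flip: pconst_mult)
  have "sign_indicator A s = pconst (1/2) * (1 + pconst (s v) * pvar v) * ?r"
    unfolding sign_indicator_def by (rule prod.remove[OF finite_vars v])
  then have "pvar v * sign_indicator A s - pconst (s v) * sign_indicator A s
      = (pconst (1/2) * ?r) * ((pvar v - pconst (s v)) * (1 + pconst (s v) * pvar v))"
    by (simp add: algebra_simps)
  also have "(pvar v - pconst (s v)) * (1 + pconst (s v) * pvar v) = pconst (s v) * (pvar v ^ 2 - 1)"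
  proof -
    have "pconst (s v) * (pconst (s v) * pvar v) = pvar v"
      by (simp add: c flip: mult.assoc)
    then show ?thesis by (simp add: algebra_simps power2_eq_square)
  qed
  finally have "pvar v * sign_indicator A s - pconst (s v) * sign_indicator A s
      = (pconst (1/2) * ?r * pconst (s v)) * (pvar v ^ 2 - 1)"
    by (simp only: mult.assoc)
  moreover have "pvars (pconst (1/2) * ?r * pconst (s v)) \<subseteq> A"
    using v by (intro pvars_closed) auto
  ultimately show ?thesis
    using mult_mem[OF _ square_mem[OF v]] by simp
qed

text \<open>Multiplying by an indicator amounts to evaluating at its point. The rule for one variable
  extends to all polynomials because it survives sums and multiplication by a further variable.\<close>
lemma mult_sign_indicator:
  assumes s: "s \<in> sign_patterns A" and p: "pvars p \<subseteq> A"
  shows "p * sign_indicator A s - pconst (peval s p) * sign_indicator A s \<in> I"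
  using p
proof (induction p rule: poly_ring_induct)
  case (pvar v p)
  let ?d = "sign_indicator A s"
  have "pvar v * (p * ?d - pconst (peval s p) * ?d)
      + pconst (peval s p) * (pvar v * ?d - pconst (s v) * ?d) \<in> I"
    using pvar by (intro add_mem mult_mem pvar_mult_sign_indicator s) auto
  then show ?case
    by (simp add: pconst_mult algebra_simps)
next
  case (add p q)
  then show ?case
    using add_mem[OF add.IH] by (simp add: pconst_add algebra_simps)
qed simp

text \<open>If some \<open>p \<in> I\<close> does not vanish at \<open>s\<close>, then \<open>p\<close> acts on the indicator of \<open>s\<close> as a nonzero
  scalar and as zero at the same time. Hence only the zeros of \<open>I\<close> survive in the quotient.\<close>
lemma sign_indicator_mem:
  assumes s: "s \<in> sign_patterns A" and p: "p \<in> I" "peval s p \<noteq> 0"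
  shows "sign_indicator A s \<in> I"
proof -
  let ?d = "sign_indicator A s"
  have "p * ?d \<in> I"
    using mult_mem[OF pvars_sign_indicator p(1)] by (simp add: mult.commute)
  from diff_mem[OF this mult_sign_indicator[OF s in_ring[OF p(1)]]]
  have "pconst (peval s p) * ?d \<in> I" by simp
  from mult_mem[OF _ this, of "pconst (1 / peval s p)"] p(2) show ?thesis
    by (simp flip: pconst_mult mult.assoc)
qed

lemma sign_indicator_idem:
  assumes s: "s \<in> sign_patterns A"
  shows "sign_indicator A s ^ 2 - sign_indicator A s \<in> I"
proof -
  have "s v * s v = 1" if "v \<in> A" for v
    using s that by (auto simp: sign_patterns_def PiE_iff)
  then have "peval s (sign_indicator A s) = 1"
    by (auto simp: sign_indicator_def peval_prod intro!: prod.neutral)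
  then show ?thesis
    using mult_sign_indicator[OF s pvars_sign_indicator, of s] by (simp add: power2_eq_square)
qed

text \<open>If every class has a representative of degree at most \<open>k\<close>, the truncated sums of squares are
  all sums of squares of the quotient ring, so an admissible functional \<open>l\<close> is nonnegative on
  the class of every indicator, which is an idempotent and hence a square. These values sum to
  \<open>l 1 = 1\<close>, and \<open>x\<^sub>v\<close> is congruent to the combination of the indicators with coefficients
  \<open>s v\<close>; therefore the point of \<open>l\<close> is the convex combination of the zeros of \<open>I\<close> with weights
  \<open>l\<close> of their indicators.\<close>
theorem theta_exact_if_representable:
  assumes rep: "\<And>f. pvars f \<subseteq> A \<Longrightarrow> \<exists>h. pvars h \<subseteq> A \<and> f - h \<in> I \<and> total_degree h \<le> k"
  shows "theta_exact A I k"
proof -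
  \<comment> \<open>sign patterns are \<open>undefined\<close> outside \<open>A\<close>, whereas points of the coordinate space vanish there\<close>
  define ext where "ext s = (\<lambda>v. if v \<in> A then s v else (0::real))" for s
  define Z where "Z = {s \<in> sign_patterns A. ext s \<in> real_zeros A I}"
  have fin: "finite (sign_patterns A)"
    unfolding sign_patterns_def by (intro finite_PiE finite_vars) auto
  have peval_ext: "peval (ext s) p = peval s p" if "pvars p \<subseteq> A" for s p
    using that unfolding peval_def ext_def pvars_def
    by (intro sum.cong refl arg_cong2[of _ _ _ _ "(*)"] prod.cong) auto
  have nonzero: "sign_indicator A s \<in> I" if "s \<in> sign_patterns A - Z" for s
  proof -
    have "ext s \<in> coord_space A" by (auto simp: ext_def coord_space_def)
    with that obtain p where "p \<in> I" "peval (ext s) p \<noteq> 0"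
      by (auto simp: Z_def real_zeros_def)
    with that show ?thesis
      using sign_indicator_mem[of s p] peval_ext[OF in_ring, of p s] by auto
  qed
  have "(\<lambda>v. if v \<in> A then l (residue_class A I (pvar v)) else 0) \<in> convex hull (real_zeros A I)"
    if l: "l \<in> sos_dual A I k" and l1: "l (residue_class A I 1) = 1" for l
  proof -
    define L where "L f = l (residue_class A I f)" for f
    have upto: "residue_class A I f \<in> classes_upto A I (2 * k)" if "pvars f \<subseteq> A" for f
    proof -
      obtain h where "f - h \<in> I" "total_degree h \<le> k" using rep[OF \<open>pvars f \<subseteq> A\<close>] by blast
      then show ?thesis by (intro residue_class_in_classes_upto[OF \<open>pvars f \<subseteq> A\<close>]) auto
    qed
    have lin: "linear_functional_on A I (classes_upto A I (2 * k)) l"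
      and pos: "\<And>C. C \<in> sos_classes A I k \<Longrightarrow> l C \<ge> 0"
      using l by (auto simp: sos_dual_def)
    have L_add: "L (f + g) = L f + L g" if "pvars f \<subseteq> A" "pvars g \<subseteq> A" for f g
      using lin upto[OF that(1)] upto[OF that(2)]
      unfolding linear_functional_on_def L_def residue_class_add[OF that, symmetric] by blast
    have L_scale: "L (pconst c * f) = c * L f" if "pvars f \<subseteq> A" for c f
    proof -
      have "residue_class A I (pconst c * f)
          = residue_class A I (pconst c) \<otimes>\<^bsub>poly_ring A Quot I\<^esub> residue_class A I f"
        using that by (simp add: residue_class_mult)
      then show ?thesis
        using lin upto[OF that] unfolding linear_functional_on_def L_def by metis
    qed
    have L_cong: "L f = L g" if "f - g \<in> I" for f g
      using residue_class_cong[OF that] by (simp add: L_def)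
    have L_0: "L 0 = 0" using L_scale[of 0 0] by simp
    have L_sum: "L (sum f S) = (\<Sum>i\<in>S. L (f i))" if "\<And>i. pvars (f i) \<subseteq> A" for f and S :: "('a \<Rightarrow> real) set"
      by (induction S rule: infinite_finite_induct) (simp_all add: L_0 L_add that pvars_sum)
    have L_square: "L (f ^ 2) \<ge> 0" if f: "pvars f \<subseteq> A" for f
    proof -
      obtain h where h: "pvars h \<subseteq> A" "f - h \<in> I" "total_degree h \<le> k" using rep[OF f] by blast
      have "f ^ 2 - h ^ 2 = (f + h) * (f - h)"
        by (simp add: power2_eq_square algebra_simps)
      then have "L (f ^ 2) = L (h ^ 2)"
        using L_cong mult_mem[OF pvars_add[OF f h(1)] h(2)] by simp
      moreover have "residue_class A I (h ^ 2) \<in> sos_classes A I k"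
        unfolding sos_classes_def using h by (intro CollectI exI[of _ "[h]"]) auto
      ultimately show ?thesis using pos by (simp add: L_def)
    qed
    have weight_nonneg: "L (sign_indicator A s) \<ge> 0" if "s \<in> sign_patterns A" for s
      using L_square[OF pvars_sign_indicator[of A s]] L_cong[OF sign_indicator_idem[OF that]] by simp
    have expand: "L p = (\<Sum>s\<in>Z. L (sign_indicator A s) * peval s p)" if p: "pvars p \<subseteq> A" for p
    proof -
      have "p = (\<Sum>s\<in>sign_patterns A. p * sign_indicator A s)"
        by (simp add: sum_sign_indicator finite_vars flip: sum_distrib_left)
      also have "L \<dots> = (\<Sum>s\<in>sign_patterns A. L (p * sign_indicator A s))"
        by (intro L_sum pvars_mult p pvars_sign_indicator)
      also have "\<dots> = (\<Sum>s\<in>sign_patterns A. L (sign_indicator A s) * peval s p)"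
        using L_cong[OF mult_sign_indicator[OF _ p]]
        by (intro sum.cong refl) (simp add: L_scale pvars_sign_indicator)
      also have "\<dots> = (\<Sum>s\<in>Z. L (sign_indicator A s) * peval s p)"
        using fin nonzero L_cong[of _ 0] L_0
        by (intro sum.mono_neutral_right) (auto simp: Z_def)
      finally show ?thesis .
    qed
    have "(\<Sum>s\<in>Z. L (sign_indicator A s) *\<^sub>R ext s) \<in> convex hull (real_zeros A I)"
    proof (rule convex_sum)
      show "(\<Sum>s\<in>Z. L (sign_indicator A s)) = 1"
        using expand[of 1] l1 by (simp add: L_def)
    qed (use fin weight_nonneg in \<open>auto simp: Z_def intro: hull_inc\<close>)
    moreover have "(\<Sum>s\<in>Z. L (sign_indicator A s) *\<^sub>R ext s)
        = (\<lambda>v. if v \<in> A then l (residue_class A I (pvar v)) else 0)"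
    proof
      fix v
      have "(\<Sum>s\<in>Z. L (sign_indicator A s) *\<^sub>R ext s) v = (\<Sum>s\<in>Z. L (sign_indicator A s) * ext s v)"
        by (induction Z rule: infinite_finite_induct) (auto simp: scaleR_fun_def)
      then show "(\<Sum>s\<in>Z. L (sign_indicator A s) *\<^sub>R ext s) v
          = (if v \<in> A then l (residue_class A I (pvar v)) else 0)"
        using expand[of "pvar v"] by (simp add: ext_def L_def)
    qed
    ultimately show ?thesis by simp
  qed
  then have "theta_body A I k \<subseteq> closure (convex hull (real_zeros A I))"
    unfolding theta_body_def by (intro closure_mono) auto
  with convex_hull_zeros_subset_theta_body show ?thesis
    unfolding theta_exact_def by blast
qed

end


section \<open>The ideal of the tensor space\<close>

lemma finite_multi_indices:
  fixes n :: "'d::finite \<Rightarrow> nat"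
  shows "finite (multi_indices n)"
proof -
  have "multi_indices n = (UNIV \<rightarrow>\<^sub>E (\<Union>i. {1..n i})) \<inter> {a. \<forall>i. a i \<in> {1..n i}}"
    by (auto simp: multi_indices_def PiE_def)
  also have "finite \<dots>"
    by (intro finite_Int disjI1 finite_PiE) auto
  finally show ?thesis .
qed

lemma multi_index_min_max:
  assumes "a \<in> multi_indices n" "b \<in> multi_indices n"
  shows "(\<lambda>i. min (a i) (b i)) \<in> multi_indices n" "(\<lambda>i. max (a i) (b i)) \<in> multi_indices n"
  using assms by (auto simp: multi_indices_def min_def max_def)

definition I_infty_generators :: "('d \<Rightarrow> nat) \<Rightarrow> ('d \<Rightarrow> nat) rpoly set" where
  "I_infty_generators n =
    {pvar a ^ 2 - 1 | a. a \<in> multi_indices n} \<union>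
    {pvar a * pvar b - pvar (\<lambda>i. min (a i) (b i)) * pvar (\<lambda>i. max (a i) (b i)) | a b.
       a \<in> multi_indices n \<and> b \<in> multi_indices n}"

lemma I_infty_ideal:
  "ideal (I_infty n) (poly_ring (multi_indices n))"
  and I_infty_generators_mem: "I_infty_generators n \<subseteq> I_infty n"
proof -
  interpret cring "poly_ring (multi_indices n)" by (rule cring_poly_ring)
  have "pvars (pvar a ^ 2 - 1) \<subseteq> multi_indices n"
    and "pvars (pvar a * pvar b - pvar (\<lambda>i. min (a i) (b i)) * pvar (\<lambda>i. max (a i) (b i)))
      \<subseteq> multi_indices n"
    if "a \<in> multi_indices n" "b \<in> multi_indices n" for a b
    using that multi_index_min_max[OF that] by (intro pvars_closed; simp)+
  then have gens: "I_infty_generators n \<subseteq> carrier (poly_ring (multi_indices n))"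
    unfolding I_infty_generators_def poly_ring_simps by blast
  show "ideal (I_infty n) (poly_ring (multi_indices n))" "I_infty_generators n \<subseteq> I_infty n"
    unfolding I_infty_def I_infty_generators_def[symmetric]
    using genideal_ideal[OF gens] genideal_self[OF gens] by auto
qed

locale tensor_ideal =
  fixes n :: "'d::finite \<Rightarrow> nat"
begin

sublocale sign_poly_ideal "multi_indices n" "I_infty n"
proof (intro sign_poly_ideal.intro poly_ideal.intro sign_poly_ideal_axioms.intro)
  show "ideal (I_infty n) (poly_ring (multi_indices n))" by (rule I_infty_ideal)
  show "pvar a ^ 2 - 1 \<in> I_infty n" if "a \<in> multi_indices n" for a
    using that I_infty_generators_mem[of n] by (auto simp: I_infty_generators_def)
qed (rule finite_multi_indices)

text \<open>Exchanging one coordinate of two multi-indices leaves their meet and their join unchanged,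
  and the product of two variables depends modulo the ideal on meet and join alone.\<close>
lemma swap_coordinate:
  assumes ab: "a \<in> multi_indices n" "b \<in> multi_indices n"
  shows "pvar a * pvar b - pvar (a(i := b i)) * pvar (b(i := a i)) \<in> I_infty n"
proof -
  let ?a = "a(i := b i)" and ?b = "b(i := a i)"
  have lattice: "pvar x * pvar y - pvar (\<lambda>i. min (x i) (y i)) * pvar (\<lambda>i. max (x i) (y i)) \<in> I_infty n"
    if "x \<in> multi_indices n" "y \<in> multi_indices n" for x y
    using that I_infty_generators_mem[of n] by (auto simp: I_infty_generators_def)
  have "?a \<in> multi_indices n" "?b \<in> multi_indices n"
    using ab by (auto simp: multi_indices_def)
  moreover have "(\<lambda>j. min (?a j) (?b j)) = (\<lambda>j. min (a j) (b j))"
    "(\<lambda>j. max (?a j) (?b j)) = (\<lambda>j. max (a j) (b j))"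
    by (auto simp: fun_eq_iff)
  ultimately show ?thesis
    using diff_mem[OF lattice[OF ab] lattice[of ?a ?b]] by simp
qed

definition swap_at :: "'d \<Rightarrow> nat \<Rightarrow> nat \<Rightarrow> (nat \<Rightarrow> 'd \<Rightarrow> nat) \<Rightarrow> nat \<Rightarrow> 'd \<Rightarrow> nat"
  where "swap_at i p q a = a(p := (a p)(i := a q i), q := (a q)(i := a p i))"

lemma swap_at_multi_indices:
  assumes "p < k" "q < k" "\<And>r. r < k \<Longrightarrow> a r \<in> multi_indices n" "r < k"
  shows "swap_at i p q a r \<in> multi_indices n"
  using assms(3)[OF assms(1)] assms(3)[OF assms(2)] assms(3)[OF assms(4)]
  by (auto simp: swap_at_def multi_indices_def)

lemma prod_swap_at:
  assumes pq: "p < k" "q < k" and a: "\<And>r. r < k \<Longrightarrow> a r \<in> multi_indices n"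
  shows "(\<Prod>r<k. pvar (a r)) - (\<Prod>r<k. pvar (swap_at i p q a r)) \<in> I_infty n"
proof (cases "p = q")
  case True
  then have "swap_at i p q a = a" by (simp add: swap_at_def)
  then show ?thesis by simp
next
  case False
  have split: "(\<Prod>r<k. pvar (f r) :: ('d \<Rightarrow> nat) rpoly)
      = (\<Prod>r\<in>{..<k} - {p} - {q}. pvar (f r)) * (pvar (f p) * pvar (f q))" for f
    using pq False prod.remove[of "{..<k}" p "\<lambda>r. pvar (f r) :: ('d \<Rightarrow> nat) rpoly"]
      prod.remove[of "{..<k} - {p}" q "\<lambda>r. pvar (f r) :: ('d \<Rightarrow> nat) rpoly"]
    by (simp add: mult_ac)
  have rest: "(\<Prod>r\<in>{..<k} - {p} - {q}. pvar (swap_at i p q a r) :: ('d \<Rightarrow> nat) rpoly)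
      = (\<Prod>r\<in>{..<k} - {p} - {q}. pvar (a r))"
    by (intro prod.cong) (auto simp: swap_at_def)
  have "(\<Prod>r<k. pvar (a r)) - (\<Prod>r<k. pvar (swap_at i p q a r))
      = (\<Prod>r\<in>{..<k} - {p} - {q}. pvar (a r))
        * (pvar (a p) * pvar (a q) - pvar ((a p)(i := a q i)) * pvar ((a q)(i := a p i)))"
    unfolding split rest using False by (simp add: swap_at_def right_diff_distrib)
  also have "\<dots> \<in> I_infty n"
    using a pq by (intro mult_mem swap_coordinate pvars_prod) auto
  finally show ?thesis .
qed

text \<open>A word longer than every \<open>n\<^sub>i\<close> has, for each coordinate \<open>i\<close>, two letters that agree in
  coordinate \<open>i\<close>. Exchanging only the \<open>i\<close>-th coordinates moves this agreement to the first two
  letters without disturbing the coordinates that are already aligned.\<close>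
lemma align_first_two:
  assumes k: "Max (range n) < k" and k2: "2 \<le> k"
    and a: "\<And>r. r < k \<Longrightarrow> a r \<in> multi_indices n"
  shows "\<exists>a'. (\<forall>r<k. a' r \<in> multi_indices n) \<and> (\<forall>i\<in>S. a' 0 i = a' 1 i) \<and>
    (\<Prod>r<k. pvar (a r)) - (\<Prod>r<k. pvar (a' r)) \<in> I_infty n"
proof -
  have "finite S" by simp
  then show ?thesis
  proof induction
    case empty
    then show ?case using a by (intro exI[of _ a]) auto
  next
    case (insert i S)
    then obtain b where b: "\<And>r. r < k \<Longrightarrow> b r \<in> multi_indices n" "\<forall>i\<in>S. b 0 i = b 1 i"
      and cong_b: "(\<Prod>r<k. pvar (a r)) - (\<Prod>r<k. pvar (b r)) \<in> I_infty n"
      by blast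
    have "(\<lambda>r. b r i) ` {..<k} \<subseteq> {1..n i}"
      using b(1) by (force simp: multi_indices_def)
    then have "card ((\<lambda>r. b r i) ` {..<k}) \<le> n i"
      using card_mono[of "{1..n i}"] by fastforce
    also have "n i \<le> Max (range n)" by simp
    finally have "\<not> inj_on (\<lambda>r. b r i) {..<k}"
      using k card_image[of "\<lambda>r. b r i" "{..<k}"] by (metis card_lessThan not_le)
    then obtain p q where pq: "p < q" "q < k" "b p i = b q i"
      unfolding inj_on_def by (metis lessThan_iff linorder_neqE_nat)
    \<comment> \<open>since \<open>p < q\<close>, the first exchange does not touch letter \<open>q\<close> and the second does not touch letter 0; in the boundary cases \<open>p = 0\<close> and \<open>q = 1\<close> an exchange is the identity\<close>
    define c where "c = swap_at i 0 p b"
    define d where "d = swap_at i 1 q c"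
    have c: "c r \<in> multi_indices n" if "r < k" for r
      unfolding c_def using that b(1) pq by (intro swap_at_multi_indices[of _ k]) auto
    have d: "d r \<in> multi_indices n" if "r < k" for r
      unfolding d_def using that c pq by (intro swap_at_multi_indices[of _ k]) auto
    have bc: "(\<Prod>r<k. pvar (b r)) - (\<Prod>r<k. pvar (c r)) \<in> I_infty n"
      unfolding c_def using b(1) pq by (intro prod_swap_at) auto
    have cd: "(\<Prod>r<k. pvar (c r)) - (\<Prod>r<k. pvar (d r)) \<in> I_infty n"
      unfolding d_def using c pq by (intro prod_swap_at) auto
    have "(\<Prod>r<k. pvar (a r)) - (\<Prod>r<k. pvar (d r)) \<in> I_infty n"
      by (rule cong_trans[OF cong_b cong_trans[OF bc cd]])
    moreover have "d 0 i = d 1 i"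
      using pq by (auto simp: c_def d_def swap_at_def)
    moreover have "d r j = b r j" if "j \<noteq> i" for r j
      using that by (auto simp: c_def d_def swap_at_def)
    moreover from calculation(2,3) have "\<forall>j\<in>insert i S. d 0 j = d 1 j"
      using b(2) by (metis insert_iff)
    ultimately show ?case
      using d by blast
  qed
qed

text \<open>Once the first two letters agree in all coordinates they are the same variable, and its
  square is congruent to 1.\<close>
lemma reduce_product:
  assumes k: "Max (range n) < k" and k2: "2 \<le> k"
    and a: "\<And>r. r < k \<Longrightarrow> a r \<in> multi_indices n"
  shows "\<exists>b. (\<forall>r<k-2. b r \<in> multi_indices n) \<and>
    (\<Prod>r<k. pvar (a r)) - (\<Prod>r<k-2. pvar (b r)) \<in> I_infty n"
proof -
  obtain c where c: "\<And>r. r < k \<Longrightarrow> c r \<in> multi_indices n" "c 0 = c 1"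
    and cong_c: "(\<Prod>r<k. pvar (a r)) - (\<Prod>r<k. pvar (c r)) \<in> I_infty n"
    using align_first_two[OF k k2, of a UNIV] a by (metis UNIV_I ext)
  define b where "b r = c (r + 2)" for r
  have "(\<Prod>r<Suc (Suc m). pvar (c r)) = (pvar (c 0) * pvar (c 1)) * (\<Prod>r<m. pvar (b r))" for m
    by (simp add: b_def mult.assoc prod.lessThan_Suc_shift del: prod.lessThan_Suc)
  moreover have "Suc (Suc (k - 2)) = k" using k2 by simp
  ultimately have "(\<Prod>r<k. pvar (c r)) = (pvar (c 0) * pvar (c 1)) * (\<Prod>r<k-2. pvar (b r))"
    by metis
  then have "(\<Prod>r<k. pvar (c r)) - (\<Prod>r<k-2. pvar (b r))
      = (\<Prod>r<k-2. pvar (b r)) * (pvar (c 0) ^ 2 - 1)"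
    using c(2) by (simp add: algebra_simps power2_eq_square)
  also have "\<dots> \<in> I_infty n"
    using c(1) k2 by (intro mult_mem square_mem pvars_prod) (auto simp: b_def)
  finally have "(\<Prod>r<k. pvar (a r)) - (\<Prod>r<k-2. pvar (b r)) \<in> I_infty n"
    by (rule cong_trans[OF cong_c])
  moreover have "b r \<in> multi_indices n" if "r < k - 2" for r
    using that c(1) by (simp add: b_def)
  ultimately show ?thesis by blast
qed

text \<open>Words lose two letters at a time; as the maximum is at least 1, a word that is still too
  long has two letters to lose.\<close>
lemma product_representative:
  fixes k :: nat
  assumes pos: "Max (range n) \<ge> 1" and "\<And>r. r < k \<Longrightarrow> a r \<in> multi_indices n"
  shows "\<exists>h. pvars h \<subseteq> multi_indices n \<and> (\<Prod>r<k. pvar (a r)) - h \<in> I_infty n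
    \<and> total_degree h \<le> Max (range n)"
  using assms(2)
proof (induction k arbitrary: a rule: less_induct)
  case (less k)
  show ?case
  proof (cases "k \<le> Max (range n)")
    case True
    have "total_degree (\<Prod>r<k. pvar (a r)) \<le> k" for k
    proof (induction k)
      case (Suc k)
      then show ?case
        using total_degree_mult_le[OF Suc.IH total_degree_pvar, of "a k"] by simp
    qed simp
    then show ?thesis
      using True less.prems
      by (intro exI[of _ "\<Prod>r<k. pvar (a r)"] conjI pvars_prod) (auto intro: le_trans)
  next
    case False
    with pos have k: "Max (range n) < k" "2 \<le> k" by linarith+
    obtain b where b: "\<And>r. r < k - 2 \<Longrightarrow> b r \<in> multi_indices n"
      "(\<Prod>r<k. pvar (a r)) - (\<Prod>r<k-2. pvar (b r)) \<in> I_infty n"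
      using reduce_product[OF k, of a] less.prems by blast
    obtain h where h: "pvars h \<subseteq> multi_indices n" "total_degree h \<le> Max (range n)"
      "(\<Prod>r<k-2. pvar (b r)) - h \<in> I_infty n"
      using less.IH[of "k - 2" b] b(1) k(2) by auto
    then show ?thesis
      using cong_trans[OF b(2) h(3)] by auto
  qed
qed

text \<open>The statement for \<open>f\<close> is generalised to products of \<open>f\<close> with words, which turns the
  multiplication by a variable in the induction into lengthening the word.\<close>
lemma representative:
  assumes pos: "Max (range n) \<ge> 1" and f: "pvars f \<subseteq> multi_indices n"
  shows "\<exists>h. pvars h \<subseteq> multi_indices n \<and> f - h \<in> I_infty n \<and> total_degree h \<le> Max (range n)"
    (is "?P f")
proof -
  have "?P (f * (\<Prod>r<k. pvar (a r)))" if "\<And>r. r < k \<Longrightarrow> a r \<in> multi_indices n"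
    for k :: nat and a
    using f that
  proof (induction f arbitrary: k a rule: poly_ring_induct)
    case (pconst c)
    obtain h where h: "pvars h \<subseteq> multi_indices n" "total_degree h \<le> Max (range n)"
      "(\<Prod>r<k. pvar (a r)) - h \<in> I_infty n"
      using product_representative[of k a] pos pconst by blast
    then show ?case
      using mult_mem[of "pconst c", OF _ h(3)] total_degree_mult_le[of "pconst c" 0 h]
      by (intro exI[of _ "pconst c * h"]) (auto simp: pvars_mult right_diff_distrib)
  next
    case (pvar v p)
    have "(a(k := v)) r \<in> multi_indices n" if "r < Suc k" for r
      using that pvar.hyps(1) pvar.prems by (cases "r = k") auto
    from pvar.IH[of "Suc k" "a(k := v)", OF this] show ?case
      by (simp add: mult_ac)
  next
    case (add p q)
    obtain h h' where h: "pvars h \<subseteq> multi_indices n" "total_degree h \<le> Max (range n)"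
      "p * (\<Prod>r<k. pvar (a r)) - h \<in> I_infty n"
      and h': "pvars h' \<subseteq> multi_indices n" "total_degree h' \<le> Max (range n)"
      "q * (\<Prod>r<k. pvar (a r)) - h' \<in> I_infty n"
      using add.IH[of k a] add.prems by blast
    then show ?case
      using add_mem[OF h(3) h'(3)]
      by (intro exI[of _ "h + h'"]) (auto simp: pvars_add total_degree_add_le algebra_simps)
  qed
  from this[of 0] show ?thesis by simp
qed

end

theorem proposition3p8:
  fixes n :: "'d::finite \<Rightarrow> nat"
  assumes "\<And>i. n i \<ge> 1"
  shows "theta_exact (multi_indices n) (I_infty n) (Max (range n))"
proof -
  interpret tensor_ideal n .
  \<comment> \<open>any coordinate will do: a single positive \<open>n\<^sub>i\<close> makes the maximum positive\<close>
  have "1 \<le> n undefined" by (rule assms)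
  also have "\<dots> \<le> Max (range n)" by simp
  finally show ?thesis
    by (intro theta_exact_if_representable representative)
qed

end
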